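(* For any $m>2$ there are full harmonic morphisms $\mathbb{R}^{2m}\to\mathbb{C}$, defined on the whole of $\mathbb{R}^{2m}$, which are holomorphic with respect to a Hermitian structure $J$ on $\mathbb{R}^{2m}$ but not holomorphic with respect to any Kähler structure on $\mathbb{R}^{2m}$. These can be chosen to be submersive.
   Context: $\mathbb{R}^{2m}$ carries its Euclidean metric. A harmonic morphism $\phi:\mathbb{R}^n\to\mathbb{C}$ is a smooth map with $\sum_i \partial^2\phi/(\partial x^i)^2=0$ and $\sum_i(\partial\phi/\partial x^i)^2=0$. An almost Hermitian structure $J$ on $\mathbb{R}^{2m}$ is a smooth choice, for each $x$, of an orthogonal linear map $J_x:T_x\mathbb{R}^{2m}\to T_x\mathbb{R}^{2m}$ with $J_x^2=-I$. It is called a Hermitian structure if it is integrable (every point has a neighbourhood with a chart $\psi$ into $\mathbb{C}^m$ satisfying $d\psi\circ J=\mathrm{i}\,d\psi$), and a Kähler structure if it is parallel, i.e. constant in $x$. A map $\phi$ is holomorphic with respect to $J$ if $d\phi(JX)=\mathrm{i}\,d\phi(X)$ for all tangent vectors $X$. A map $\phi:\mathbb{R}^n\to\mathbb{C}$ is full if it cannot be written as $\phi=\psi\circ\pi_A$ for some orthogonal projection $\pi_A$ of $\mathbb{R}^n$ onto a proper linear subspace $A$ and some map $\psi:A\to\mathbb{C}$. *)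

theory Defs
  imports "HOL-Analysis.Analysis"
begin

(* Only meaningful for open S, where the derivative at x does not depend on values off S.
   In finite dimensions this is the usual C^k condition. *)
primrec Ck_on :: "nat \<Rightarrow> ('a::real_normed_vector \<Rightarrow> 'b::real_normed_vector) \<Rightarrow> 'a set \<Rightarrow> bool" where
  "Ck_on 0 f S \<longleftrightarrow> continuous_on S f"
| "Ck_on (Suc k) f S \<longleftrightarrow>
     (\<forall>x\<in>S. f differentiable (at x)) \<and>
     (\<forall>v. Ck_on k (\<lambda>x. frechet_derivative f (at x) v) S)"

definition smooth_on :: "('a::real_normed_vector \<Rightarrow> 'b::real_normed_vector) \<Rightarrow> 'a set \<Rightarrow> bool" where
  "smooth_on f S \<longleftrightarrow> (\<forall>k. Ck_on k f S)"

definition partial_deriv :: "'n::finite \<Rightarrow> (real ^ 'n \<Rightarrow> complex) \<Rightarrow> real ^ 'n \<Rightarrow> complex" where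
  "partial_deriv i f x = frechet_derivative f (at x) (axis i 1)"

definition harmonic_morphism :: "(real ^ 'n::finite \<Rightarrow> complex) \<Rightarrow> bool" where
  "harmonic_morphism \<phi> \<longleftrightarrow>
     smooth_on \<phi> UNIV \<and>
     (\<forall>x. (\<Sum>i\<in>UNIV. partial_deriv i (partial_deriv i \<phi>) x) = 0) \<and>
     (\<forall>x. (\<Sum>i\<in>UNIV. (partial_deriv i \<phi> x)\<^sup>2) = 0)"

(* Each tangent space is identified with the vector space itself.  As J x is linear,
   smoothness of all J . v says that the matrix entries of J are smooth. *)
definition almost_hermitian_structure :: "(real ^ 'n::finite \<Rightarrow> real ^ 'n \<Rightarrow> real ^ 'n) \<Rightarrow> bool" where
  "almost_hermitian_structure J \<longleftrightarrow>
     (\<forall>x. orthogonal_transformation (J x)) \<and>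
     (\<forall>x v. J x (J x v) = - v) \<and>
     (\<forall>v. smooth_on (\<lambda>x. J x v) UNIV)"

definition smooth_chart :: "('a::real_normed_vector \<Rightarrow> 'b::real_normed_vector) \<Rightarrow> 'a set \<Rightarrow> bool" where
  "smooth_chart \<psi> U \<longleftrightarrow>
     open U \<and> open (\<psi> ` U) \<and> inj_on \<psi> U \<and>
     smooth_on \<psi> U \<and> smooth_on (inv_into U \<psi>) (\<psi> ` U)"

(* The index type 'm + 'm has 2 * CARD('m) elements, so real ^ ('m + 'm) is Euclidean
   2m-space; the splitting of the index type plays no role. *)
definition integrable_structure ::
    "(real ^ ('m::finite + 'm) \<Rightarrow> real ^ ('m + 'm) \<Rightarrow> real ^ ('m + 'm)) \<Rightarrow> bool" where
  "integrable_structure J \<longleftrightarrow>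
     (\<forall>p. \<exists>U (\<psi> :: real ^ ('m + 'm) \<Rightarrow> complex ^ 'm).
        p \<in> U \<and> smooth_chart \<psi> U \<and>
        (\<forall>x\<in>U. \<forall>v. frechet_derivative \<psi> (at x) (J x v) = \<i> *s frechet_derivative \<psi> (at x) v))"

definition hermitian_structure ::
    "(real ^ ('m::finite + 'm) \<Rightarrow> real ^ ('m + 'm) \<Rightarrow> real ^ ('m + 'm)) \<Rightarrow> bool" where
  "hermitian_structure J \<longleftrightarrow> almost_hermitian_structure J \<and> integrable_structure J"

definition kaehler_structure :: "(real ^ 'n::finite \<Rightarrow> real ^ 'n \<Rightarrow> real ^ 'n) \<Rightarrow> bool" where
  "kaehler_structure J \<longleftrightarrow> almost_hermitian_structure J \<and> (\<forall>x y. J x = J y)"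

definition holomorphic_wrt ::
    "(real ^ 'n::finite \<Rightarrow> real ^ 'n \<Rightarrow> real ^ 'n) \<Rightarrow> (real ^ 'n \<Rightarrow> complex) \<Rightarrow> bool" where
  "holomorphic_wrt J \<phi> \<longleftrightarrow>
     (\<forall>x. \<phi> differentiable (at x)) \<and>
     (\<forall>x v. frechet_derivative \<phi> (at x) (J x v) = \<i> * frechet_derivative \<phi> (at x) v)"

definition orthogonal_projection_onto :: "(real ^ 'n::finite) set \<Rightarrow> (real ^ 'n \<Rightarrow> real ^ 'n) \<Rightarrow> bool" where
  "orthogonal_projection_onto A P \<longleftrightarrow>
     subspace A \<and> (\<forall>x. P x \<in> A \<and> (\<forall>a\<in>A. orthogonal (x - P x) a))"

(* Values of \<psi> outside the subspace A are irrelevant. *)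
definition full :: "(real ^ 'n::finite \<Rightarrow> complex) \<Rightarrow> bool" where
  "full \<phi> \<longleftrightarrow>
     \<not> (\<exists>A P \<psi>. subspace A \<and> A \<noteq> UNIV \<and> orthogonal_projection_onto A P \<and> \<phi> = \<psi> \<circ> P)"

definition submersive :: "(real ^ 'n::finite \<Rightarrow> complex) \<Rightarrow> bool" where
  "submersive \<phi> \<longleftrightarrow> (\<forall>x. \<phi> differentiable (at x) \<and> surj (frechet_derivative \<phi> (at x)))"

end

theory Submission
  imports Defs
begin

text \<open>Let \<open>q\<^sub>k\<close> be the complex coordinates, and single out three of them, \<open>q\<^sub>a, q\<^sub>b, q\<^sub>c\<close>. The functions
  \<open>w\<^sub>a = q\<^sub>a - q\<^sub>c cnj q\<^sub>b\<close>, \<open>w\<^sub>b = q\<^sub>b + q\<^sub>c cnj q\<^sub>a\<close> and \<open>w\<^sub>k = q\<^sub>k\<close> otherwise form a global chart whose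
  differentials span an isotropic space at each point, so they are the holomorphic coordinates of
  a Hermitian structure, which depends on \<open>q\<^sub>c\<close>. For holomorphic \<open>F\<close> the terms
  \<open>\<partial>\<^sub>a\<partial>\<^sub>b F\<close> in the Laplacian of \<open>F(w)\<close> cancel, so \<open>F(w)\<close> is a harmonic morphism. The choice
  \<open>\<phi> = w\<^sub>a + w\<^sub>b\<^sup>2 + \<Sum>\<^sub>k w\<^sub>k\<^sup>2\<close> (sum over the \<open>k\<close> other than \<open>a, b, c\<close>) is not degenerate: the
  differentials of \<open>\<phi>\<close> at all points span more than all the \<open>dq\<^sub>k\<close>. This gives fullness,
  and it leaves the standard structure as the only candidate for a Kaehler structure, for which
  \<open>\<phi>\<close> is not holomorphic.\<close>

section \<open>Calculus of \<open>C\<^sup>k\<close> maps\<close>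

lemma frechet_derivative_eq: "(f has_derivative f') (at x) \<Longrightarrow> frechet_derivative f (at x) v = f' v"
  by (metis frechet_derivative_at)

text \<open>Differentiability is local on an open set, so agreement on \<open>S\<close> passes to
  the derivatives at points of \<open>S\<close> and the induction proceeds with these.\<close>

lemma Ck_on_cong:
  assumes "open S" "\<forall>x\<in>S. f x = g x" "Ck_on k f S"
  shows "Ck_on k g S"
  using assms(2,3)
proof (induction k arbitrary: f g)
  case 0
  then show ?case by (simp add: continuous_on_eq)
next
  case (Suc k)
  have der: "(g has_derivative frechet_derivative f (at x)) (at x)" if x: "x \<in> S" for x
  proof -
    have "(f has_derivative frechet_derivative f (at x)) (at x)"
      using Suc.prems(2) x frechet_derivative_works by auto
    then show ?thesis
      by (rule has_derivative_transform_within_open[OF _ assms(1) x]) (use Suc.prems in auto)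
  qed
  have "Ck_on k (\<lambda>x. frechet_derivative g (at x) v) S" for v
    by (rule Suc.IH[of "\<lambda>x. frechet_derivative f (at x) v"])
      (use Suc.prems in \<open>auto simp: frechet_derivative_eq[OF der]\<close>)
  then show ?case
    using der by (auto simp: differentiable_def)
qed

text \<open>Lets an explicit derivative formula stand in for \<open>frechet_derivative\<close>; the
  closure properties below are inductions that use it in the successor step.\<close>

lemma Ck_on_Suc_derivI:
  assumes "open S" "\<And>x. x \<in> S \<Longrightarrow> (f has_derivative f' x) (at x)"
    and "\<And>v. Ck_on k (\<lambda>x. f' x v) S"
  shows "Ck_on (Suc k) f S"
proof -
  have "Ck_on k (\<lambda>x. frechet_derivative f (at x) v) S" for v
    by (rule Ck_on_cong[OF assms(1) _ assms(3)[of v]])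
      (auto simp: frechet_derivative_eq[OF assms(2)])
  then show ?thesis
    using assms(2) by (auto simp: differentiable_def)
qed

lemma Ck_on_has_derivative:
  assumes "Ck_on (Suc k) f S" "x \<in> S"
  shows "(f has_derivative frechet_derivative f (at x)) (at x)"
  using assms frechet_derivative_works by auto

lemma Ck_on_Suc_imp:
  assumes "Ck_on (Suc k) f S"
  shows "Ck_on k f S"
  using assms
proof (induction k arbitrary: f)
  case 0
  then show ?case
    by (auto intro!: continuous_at_imp_continuous_on differentiable_imp_continuous_within)
next
  case (Suc k)
  then show ?case
    by (metis Ck_on.simps(2))
qed

lemma Ck_on_const: "Ck_on k (\<lambda>x. c) S"
  by (induction k arbitrary: c) (auto simp: frechet_derivative_const)

lemma Ck_on_bounded_linear:
  assumes "open S" "bounded_linear L"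
  shows "Ck_on k L S"
proof (cases k)
  case 0
  then show ?thesis
    using assms(2) by (simp add: linear_continuous_on)
next
  case (Suc n)
  show ?thesis
    unfolding Suc
    by (rule Ck_on_Suc_derivI[where f' = "\<lambda>x. L"])
      (auto simp: assms Ck_on_const bounded_linear_imp_has_derivative)
qed

lemma Ck_on_bounded_linear_comp:
  assumes "open S" "bounded_linear L" "Ck_on k f S"
  shows "Ck_on k (\<lambda>x. L (f x)) S"
  using assms(3)
proof (induction k arbitrary: f)
  case 0
  then show ?case
    using assms(2) by (simp add: bounded_linear.continuous_on)
next
  case (Suc k)
  show ?case
  proof (rule Ck_on_Suc_derivI[where f' = "\<lambda>x v. L (frechet_derivative f (at x) v)"])
    show "((\<lambda>x. L (f x)) has_derivative (\<lambda>v. L (frechet_derivative f (at x) v))) (at x)"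
      if "x \<in> S" for x
      by (rule bounded_linear.has_derivative[OF assms(2) Ck_on_has_derivative[OF Suc.prems that]])
  qed (use Suc assms in auto)
qed

lemma Ck_on_add:
  assumes "open S" "Ck_on k f S" "Ck_on k g S"
  shows "Ck_on k (\<lambda>x. f x + g x) S"
  using assms(2,3)
proof (induction k arbitrary: f g)
  case 0
  then show ?case by (simp add: continuous_on_add)
next
  case (Suc k)
  show ?case
  proof (rule Ck_on_Suc_derivI
      [where f' = "\<lambda>x v. frechet_derivative f (at x) v + frechet_derivative g (at x) v"])
    show "((\<lambda>x. f x + g x) has_derivative
        (\<lambda>v. frechet_derivative f (at x) v + frechet_derivative g (at x) v)) (at x)"
      if "x \<in> S" for x
      using Suc.prems that by (intro has_derivative_add Ck_on_has_derivative)
  qed (use Suc assms in auto)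
qed

lemma Ck_on_bilinear:
  assumes "open S" "bounded_bilinear bil" "Ck_on k f S" "Ck_on k g S"
  shows "Ck_on k (\<lambda>x. bil (f x) (g x)) S"
  using assms(3,4)
proof (induction k arbitrary: f g)
  case 0
  then show ?case
    using assms(2) by (simp add: bounded_bilinear.continuous_on)
next
  case (Suc k)
  \<comment> \<open>In each term of the product rule one factor stays undifferentiated, so it is
    needed with one order of smoothness less.\<close>
  note fg = Ck_on_Suc_imp[OF Suc.prems(1)] Ck_on_Suc_imp[OF Suc.prems(2)]
  show ?case
  proof (rule Ck_on_Suc_derivI[where f' = "\<lambda>x v. bil (f x) (frechet_derivative g (at x) v)
        + bil (frechet_derivative f (at x) v) (g x)"])
    show "((\<lambda>x. bil (f x) (g x)) has_derivative
        (\<lambda>v. bil (f x) (frechet_derivative g (at x) v)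
          + bil (frechet_derivative f (at x) v) (g x))) (at x)"
      if "x \<in> S" for x
      using Suc.prems that
      by (intro bounded_bilinear.FDERIV[OF assms(2)] Ck_on_has_derivative)
    show "Ck_on k (\<lambda>x. bil (f x) (frechet_derivative g (at x) v)
        + bil (frechet_derivative f (at x) v) (g x)) S" for v
      using Suc.prems fg by (intro Ck_on_add assms(1) Suc.IH) auto
  qed (use assms in auto)
qed

lemma Ck_on_inverse:
  fixes f :: "'a::real_normed_vector \<Rightarrow> 'b::real_normed_field"
  assumes "open S" "\<And>x. x \<in> S \<Longrightarrow> f x \<noteq> 0" "Ck_on k f S"
  shows "Ck_on k (\<lambda>x. inverse (f x)) S"
  using assms(3)
proof (induction k)
  case 0
  then show ?case
    using assms(2) by (simp add: continuous_on_inverse)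
next
  case (Suc k)
  note inv = Suc.IH[OF Ck_on_Suc_imp[OF Suc.prems]]
  show ?case
  \<comment> \<open>The derivative of \<open>1/f\<close> contains \<open>1/f\<close> itself, which
    is covered by the induction hypothesis at order \<open>k\<close>.\<close>
  proof (rule Ck_on_Suc_derivI[where
        f' = "\<lambda>x v. - (inverse (f x) * frechet_derivative f (at x) v * inverse (f x))"])
    show "((\<lambda>x. inverse (f x)) has_derivative
        (\<lambda>v. - (inverse (f x) * frechet_derivative f (at x) v * inverse (f x)))) (at x)"
      if "x \<in> S" for x
      by (rule Deriv.has_derivative_inverse[OF assms(2)[OF that] Ck_on_has_derivative[OF Suc.prems that]])
    show "Ck_on k (\<lambda>x. - (inverse (f x) * frechet_derivative f (at x) v * inverse (f x))) S" for v
      using Suc.prems inv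
      by (intro Ck_on_bounded_linear_comp[OF assms(1) bounded_linear_minus[OF bounded_linear_ident]]
          Ck_on_bilinear[OF assms(1) bounded_bilinear_mult]) auto
  qed (use assms in auto)
qed

lemma smooth_on_const: "smooth_on (\<lambda>x. c) S"
  by (simp add: smooth_on_def Ck_on_const)

lemma smooth_on_bounded_linear: "open S \<Longrightarrow> bounded_linear L \<Longrightarrow> smooth_on L S"
  by (simp add: smooth_on_def Ck_on_bounded_linear)

lemma smooth_on_bounded_linear_comp:
  "open S \<Longrightarrow> bounded_linear L \<Longrightarrow> smooth_on f S \<Longrightarrow> smooth_on (\<lambda>x. L (f x)) S"
  by (simp add: smooth_on_def Ck_on_bounded_linear_comp)

lemma smooth_on_add:
  "open S \<Longrightarrow> smooth_on f S \<Longrightarrow> smooth_on g S \<Longrightarrow> smooth_on (\<lambda>x. f x + g x) S"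
  by (simp add: smooth_on_def Ck_on_add)

lemma smooth_on_diff:
  "open S \<Longrightarrow> smooth_on f S \<Longrightarrow> smooth_on g S \<Longrightarrow> smooth_on (\<lambda>x. f x - g x) S"
  using smooth_on_add[of S f "\<lambda>x. - g x"]
    smooth_on_bounded_linear_comp[OF _ bounded_linear_minus[OF bounded_linear_ident], of S g]
  by simp

lemma smooth_on_sum:
  "open S \<Longrightarrow> (\<And>i. i \<in> I \<Longrightarrow> smooth_on (f i) S) \<Longrightarrow> smooth_on (\<lambda>x. \<Sum>i\<in>I. f i x) S"
  by (induction I rule: infinite_finite_induct) (auto simp: smooth_on_const smooth_on_add)

lemma smooth_on_mult:
  fixes f g :: "'a::real_normed_vector \<Rightarrow> 'b::real_normed_algebra"
  shows "open S \<Longrightarrow> smooth_on f S \<Longrightarrow> smooth_on g S \<Longrightarrow> smooth_on (\<lambda>x. f x * g x) S"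
  by (simp add: smooth_on_def Ck_on_bilinear[OF _ bounded_bilinear_mult])

lemma smooth_on_power:
  fixes f :: "'a::real_normed_vector \<Rightarrow> 'b::real_normed_algebra_1"
  shows "open S \<Longrightarrow> smooth_on f S \<Longrightarrow> smooth_on (\<lambda>x. f x ^ n) S"
  by (induction n) (auto simp: smooth_on_const smooth_on_mult)

lemma smooth_on_divide:
  fixes f g :: "'a::real_normed_vector \<Rightarrow> 'b::real_normed_field"
  assumes "open S" "smooth_on f S" "smooth_on g S" "\<And>x. x \<in> S \<Longrightarrow> g x \<noteq> 0"
  shows "smooth_on (\<lambda>x. f x / g x) S"
  using smooth_on_mult[OF assms(1,2), of "\<lambda>x. inverse (g x)"] assms
  by (simp add: smooth_on_def Ck_on_inverse field_class.field_divide_inverse)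

lemma smooth_on_cnj: "open S \<Longrightarrow> smooth_on f S \<Longrightarrow> smooth_on (\<lambda>x. cnj (f x)) S"
  by (rule smooth_on_bounded_linear_comp[OF _ bounded_linear_cnj])

lemma bounded_linear_axis: "bounded_linear (axis i :: 'b::euclidean_space \<Rightarrow> 'b ^ 'n::finite)"
  unfolding linear_conv_bounded_linear[symmetric]
  by (rule linearI) (auto simp: axis_def vec_eq_iff)

lemma smooth_on_vec:
  fixes f :: "'a::real_normed_vector \<Rightarrow> 'b::euclidean_space ^ 'n::finite"
  assumes "open S" "\<And>i. smooth_on (\<lambda>x. f x $ i) S"
  shows "smooth_on f S"
proof -
  have "f = (\<lambda>x. \<Sum>i\<in>UNIV. axis i (f x $ i))"
    by (auto simp: vec_eq_iff fun_eq_iff axis_def)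
  moreover have "smooth_on (\<lambda>x. \<Sum>i\<in>UNIV. axis i (f x $ i)) S"
    by (intro smooth_on_sum smooth_on_bounded_linear_comp[OF _ bounded_linear_axis] assms)
  ultimately show ?thesis
    by simp
qed

lemma smooth_on_imp_differentiable: "smooth_on f S \<Longrightarrow> x \<in> S \<Longrightarrow> f differentiable (at x)"
  unfolding smooth_on_def by (metis Ck_on.simps(2))

lemma frechet_derivative_nth:
  fixes f :: "'a::real_normed_vector \<Rightarrow> 'b::real_normed_vector ^ 'n::finite"
  assumes "f differentiable (at x)"
  shows "frechet_derivative f (at x) v $ i = frechet_derivative (\<lambda>y. f y $ i) (at x) v"
  using bounded_linear.has_derivative[OF bounded_linear_vec_nth] assms
  by (metis frechet_derivative_eq frechet_derivative_works)

section \<open>Complex coordinates\<close>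

definition cplx :: "real ^ ('m::finite + 'm) \<Rightarrow> complex ^ 'm" where
  "cplx x = (\<chi> k. Complex (x $ Inl k) (x $ Inr k))"

definition realify :: "complex ^ 'm::finite \<Rightarrow> real ^ ('m + 'm)" where
  "realify z = (\<chi> s. case s of Inl k \<Rightarrow> Re (z $ k) | Inr k \<Rightarrow> Im (z $ k))"

lemma cplx_realify [simp]: "cplx (realify z) = z"
  by (simp add: cplx_def realify_def vec_eq_iff)

lemma realify_cplx [simp]: "realify (cplx x) = x"
  by (auto simp: cplx_def realify_def vec_eq_iff split: sum.split)

lemma linear_cplx: "linear cplx"
  by (rule linearI) (auto simp: cplx_def vec_eq_iff complex_eq_iff)

lemma linear_realify: "linear realify"
  by (rule linearI) (auto simp: realify_def vec_eq_iff split: sum.split)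

lemmas bounded_linear_cplx = linear_cplx[unfolded linear_conv_bounded_linear]
lemmas bounded_linear_realify = linear_realify[unfolded linear_conv_bounded_linear]

lemma cplx_axis:
  "cplx (axis (Inl k) 1) = axis k 1" "cplx (axis (Inr k) 1) = axis k \<i>"
  by (auto simp: cplx_def axis_def vec_eq_iff complex_eq_iff)

lemma sum_UNIV_Plus:
  "(\<Sum>s\<in>UNIV. f s) = (\<Sum>k\<in>UNIV. f (Inl k) + f (Inr k))"
  for f :: "'m::finite + 'm \<Rightarrow> 'a::comm_monoid_add"
  by (subst UNIV_Plus_UNIV[symmetric], subst sum.Plus) (simp_all add: sum.distrib)

lemma inner_cplx: "cplx x \<bullet> cplx y = x \<bullet> y"
  by (simp add: inner_vec_def sum_UNIV_Plus cplx_def inner_complex_def)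

lemma norm_realify: "norm (realify z) = norm z"
  using inner_cplx[of "realify z" "realify z"] by (simp add: norm_eq)

lemma has_derivative_cplx_nth [derivative_intros]:
  "((\<lambda>x. cplx x $ k) has_derivative (\<lambda>v. cplx v $ k)) F"
  by (rule bounded_linear_imp_has_derivative)
    (rule bounded_linear_compose[OF bounded_linear_vec_nth bounded_linear_cplx])

lemma has_derivative_cnj' [derivative_intros]:
  "(f has_derivative f') F \<Longrightarrow> ((\<lambda>x. cnj (f x)) has_derivative (\<lambda>v. cnj (f' v))) F"
  by (rule bounded_linear.has_derivative[OF bounded_linear_cnj])

lemma smooth_on_cplx_nth: "smooth_on (\<lambda>x. cplx x $ k) UNIV"
  by (rule smooth_on_bounded_linear[OF open_UNIV
        bounded_linear_compose[OF bounded_linear_vec_nth bounded_linear_cplx]])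

lemma smooth_on_nth: "smooth_on (\<lambda>z. z $ k) UNIV"
  by (rule smooth_on_bounded_linear[OF open_UNIV bounded_linear_vec_nth])

text \<open>The number is real and at least 1. It is the denominator in \<open>chart_inv\<close> and
  \<open>Jc\<close>.\<close>

lemma one_plus_cmod_neq_0: "1 + u * cnj u \<noteq> 0"
proof -
  have "1 + u * cnj u = of_real (1 + (cmod u)\<^sup>2)"
    using complex_norm_square[of u] by simp
  also have "\<dots> \<noteq> 0"
    by (metis add_nonneg_eq_0_iff of_real_eq_0_iff zero_le_one zero_le_power2 zero_neq_one)
  finally show ?thesis .
qed

lemmas smooth_intros = smooth_on_const smooth_on_add smooth_on_diff smooth_on_mult smooth_on_power
  smooth_on_sum smooth_on_divide smooth_on_cnj smooth_on_cplx_nth smooth_on_nth open_UNIV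
  one_plus_cmod_neq_0

section \<open>The example\<close>

locale distinct_triple =
  fixes a b c :: "'m::finite"
  assumes neq: "a \<noteq> b" "a \<noteq> c" "b \<noteq> c"
begin

lemmas neqs = neq neq[symmetric]

definition chart :: "complex ^ 'm \<Rightarrow> complex ^ 'm" where
  "chart z = (\<chi> k. if k = a then z $ a - z $ c * cnj (z $ b)
     else if k = b then z $ b + z $ c * cnj (z $ a) else z $ k)"

text \<open>For fixed \<open>u = w $ c\<close>, \<open>chart\<close> is a complex linear system in
  \<open>z $ a\<close> and \<open>cnj (z $ b)\<close> with determinant \<open>1 + u * cnj u\<close>;
  this is Cramer's rule.\<close>

definition chart_inv :: "complex ^ 'm \<Rightarrow> complex ^ 'm" where
  "chart_inv w = (\<chi> k. if k = a then (w $ a + w $ c * cnj (w $ b)) / (1 + w $ c * cnj (w $ c))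
     else if k = b then (w $ b - w $ c * cnj (w $ a)) / (1 + w $ c * cnj (w $ c)) else w $ k)"

definition dchart :: "complex ^ 'm \<Rightarrow> complex ^ 'm \<Rightarrow> complex ^ 'm" where
  "dchart z v = (\<chi> k. if k = a then v $ a - (v $ c * cnj (z $ b) + z $ c * cnj (v $ b))
     else if k = b then v $ b + (v $ c * cnj (z $ a) + z $ c * cnj (v $ a)) else v $ k)"

text \<open>Solving \<open>p\<^sub>a' - u cnj p\<^sub>b' = \<i> (p\<^sub>a - u cnj p\<^sub>b)\<close> and \<open>p\<^sub>b' + u cnj p\<^sub>a' = \<i> (p\<^sub>b + u cnj p\<^sub>a)\<close>
  for \<open>p'\<close> gives the following formulas.\<close>

definition Jc :: "complex \<Rightarrow> complex ^ 'm \<Rightarrow> complex ^ 'm" where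
  "Jc u p = (\<chi> k.
     if k = a then \<i> * ((1 - u * cnj u) * p $ a - 2 * u * cnj (p $ b)) / (1 + u * cnj u)
     else if k = b then \<i> * ((1 - u * cnj u) * p $ b + 2 * u * cnj (p $ a)) / (1 + u * cnj u)
     else \<i> * p $ k)"

definition J :: "real ^ ('m + 'm) \<Rightarrow> real ^ ('m + 'm) \<Rightarrow> real ^ ('m + 'm)" where
  "J x v = realify (Jc (cplx x $ c) (cplx v))"

definition \<phi> :: "real ^ ('m + 'm) \<Rightarrow> complex" where
  "\<phi> x = chart (cplx x) $ a + (chart (cplx x) $ b)\<^sup>2 + (\<Sum>k\<in>-{a,b,c}. (cplx x $ k)\<^sup>2)"

definition D :: "complex ^ 'm \<Rightarrow> complex ^ 'm \<Rightarrow> complex" where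
  "D z v = dchart z v $ a + 2 * chart z $ b * dchart z v $ b + (\<Sum>k\<in>-{a,b,c}. 2 * z $ k * v $ k)"

text \<open>\<open>D\<close> and \<open>H\<close> are the first and second differentials of \<open>\<phi>\<close> in complex coordinates.\<close>

definition H :: "complex ^ 'm \<Rightarrow> complex ^ 'm \<Rightarrow> complex ^ 'm \<Rightarrow> complex" where
  "H z v w = - (v $ c * cnj (w $ b) + w $ c * cnj (v $ b)) + 2 * dchart z w $ b * dchart z v $ b
     + 2 * chart z $ b * (v $ c * cnj (w $ a) + w $ c * cnj (v $ a))
     + (\<Sum>k\<in>-{a,b,c}. 2 * w $ k * v $ k)"

section \<open>The global chart and its Hermitian structure\<close>

lemma chart_nth [simp]:
  "chart z $ a = z $ a - z $ c * cnj (z $ b)"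
  "chart z $ b = z $ b + z $ c * cnj (z $ a)"
  "k \<noteq> a \<Longrightarrow> k \<noteq> b \<Longrightarrow> chart z $ k = z $ k"
  using neqs by (auto simp: chart_def)

lemma dchart_nth [simp]:
  "dchart z v $ a = v $ a - (v $ c * cnj (z $ b) + z $ c * cnj (v $ b))"
  "dchart z v $ b = v $ b + (v $ c * cnj (z $ a) + z $ c * cnj (v $ a))"
  "k \<noteq> a \<Longrightarrow> k \<noteq> b \<Longrightarrow> dchart z v $ k = v $ k"
  using neqs by (auto simp: dchart_def)

lemma Jc_nth:
  "Jc u p $ a = \<i> * ((1 - u * cnj u) * p $ a - 2 * u * cnj (p $ b)) / (1 + u * cnj u)"
  "Jc u p $ b = \<i> * ((1 - u * cnj u) * p $ b + 2 * u * cnj (p $ a)) / (1 + u * cnj u)"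
  "k \<noteq> a \<Longrightarrow> k \<noteq> b \<Longrightarrow> Jc u p $ k = \<i> * p $ k"
  using neqs by (auto simp: Jc_def)

lemma index_cases:
  obtains "k = a" | "k = b" | "k \<noteq> a" "k \<noteq> b"
  by blast

lemma smooth_chart_nth: "smooth_on (\<lambda>x. chart (cplx x) $ k) UNIV"
  by (rule index_cases[of k]) (auto intro!: smooth_intros)

lemma chart_has_derivative [derivative_intros]:
  "((\<lambda>x. chart (cplx x) $ k) has_derivative (\<lambda>v. dchart (cplx x) (cplx v) $ k)) (at x)"
  by (rule index_cases[of k]) (auto intro!: derivative_eq_intros simp: fun_eq_iff algebra_simps)

lemma chart_inv_chart: "chart_inv (chart z) = z"
  using one_plus_cmod_neq_0[of "z $ c"] neqs
  by (auto simp: vec_eq_iff chart_inv_def field_simps)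

lemma chart_chart_inv: "chart (chart_inv w) = w"
proof -
  have "chart (chart_inv w) $ k = w $ k" for k
    \<comment> \<open>\<open>chart\<close> conjugates components of \<open>chart_inv w\<close>,
      which turns the denominator into \<open>1 + cnj u * u\<close>; both forms must be known to be
      nonzero.\<close>
    using one_plus_cmod_neq_0[of "w $ c"] one_plus_cmod_neq_0[of "cnj (w $ c)"] neqs
    by (cases k rule: index_cases)
      (simp_all add: chart_inv_def divide_simps, simp_all add: algebra_simps)
  then show ?thesis
    by (simp add: vec_eq_iff)
qed

lemma Jc_holomorphic:
  "(Jc u p $ a) - u * cnj (Jc u p $ b) = \<i> * (p $ a - u * cnj (p $ b))"
  "(Jc u p $ b) + u * cnj (Jc u p $ a) = \<i> * (p $ b + u * cnj (p $ a))"
  using one_plus_cmod_neq_0[of u] one_plus_cmod_neq_0[of "cnj u"]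
  by (simp_all add: Jc_nth divide_simps) (simp_all add: algebra_simps)

text \<open>Differentiating the coefficient \<open>z $ c\<close> produces terms in
  \<open>v $ c\<close> alone, and \<open>Jc\<close> multiplies \<open>v $ c\<close> by \<i>. The
  other terms are handled by \<open>Jc_holomorphic\<close>.\<close>

lemma dchart_Jc: "dchart z (Jc (z $ c) v) = \<i> *s dchart z v"
proof -
  have "dchart z (Jc (z $ c) v) $ k = \<i> * dchart z v $ k" for k
    using Jc_holomorphic[of "z $ c" v] neqs
    by (cases k rule: index_cases) (auto simp: Jc_nth(3) algebra_simps)
  then show ?thesis
    by (simp add: vec_eq_iff)
qed

text \<open>\<open>D z\<close> is a complex linear combination of components of
  \<open>dchart z\<close>, hence inherits \<open>dchart_Jc\<close>.\<close>

lemma D_Jc: "D z (Jc (z $ c) v) = \<i> * D z v"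
proof -
  have "(\<Sum>k\<in>-{a,b,c}. 2 * z $ k * Jc (z $ c) v $ k) = \<i> * (\<Sum>k\<in>-{a,b,c}. 2 * z $ k * v $ k)"
    by (auto simp: sum_distrib_left Jc_nth(3) intro!: sum.cong)
  then show ?thesis
    by (simp only: D_def dchart_Jc vector_smult_component) (simp add: algebra_simps)
qed

lemma Jc_Jc: "Jc u (Jc u p) = - p"
proof -
  have "Jc u (Jc u p) $ k = - p $ k" for k
    using one_plus_cmod_neq_0[of u] one_plus_cmod_neq_0[of "cnj u"]
    by (cases k rule: index_cases)
      (simp_all add: Jc_nth divide_simps, simp_all add: algebra_simps)
  then show ?thesis
    by (simp add: vec_eq_iff)
qed

lemma sum_split: "(\<Sum>k\<in>UNIV. f k) = f a + f b + (\<Sum>k\<in>-{a,b}. f k)"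
  for f :: "'m \<Rightarrow> 'x::comm_monoid_add"
proof -
  have "UNIV = insert a (insert b (-{a,b}))"
    by auto
  then have "(\<Sum>k\<in>UNIV. f k) = sum f (insert a (insert b (-{a,b})))"
    by metis
  then show ?thesis
    using neqs by (simp add: add.assoc)
qed

lemma norm_Jc: "norm (Jc u p) = norm p"
proof -
  \<comment> \<open>Only the components \<open>a\<close> and \<open>b\<close> are mixed. Writing
    squared moduli as products with the conjugate makes this an identity of rational
    expressions.\<close>
  have "complex_of_real ((cmod (Jc u p $ a))\<^sup>2 + (cmod (Jc u p $ b))\<^sup>2)
      = complex_of_real ((cmod (p $ a))\<^sup>2 + (cmod (p $ b))\<^sup>2)"
    unfolding of_real_add complex_norm_square
    using one_plus_cmod_neq_0[of u] one_plus_cmod_neq_0[of "cnj u"]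
    by (simp add: Jc_nth divide_simps) (simp add: algebra_simps)
  then have "(cmod (Jc u p $ a))\<^sup>2 + (cmod (Jc u p $ b))\<^sup>2
      = (cmod (p $ a))\<^sup>2 + (cmod (p $ b))\<^sup>2"
    by (simp only: of_real_eq_iff)
  moreover have "(\<Sum>k\<in>-{a,b}. (cmod (Jc u p $ k))\<^sup>2) = (\<Sum>k\<in>-{a,b}. (cmod (p $ k))\<^sup>2)"
    by (rule sum.cong) (auto simp: Jc_nth(3) norm_mult)
  ultimately have "(\<Sum>k\<in>UNIV. (cmod (Jc u p $ k))\<^sup>2) = (\<Sum>k\<in>UNIV. (cmod (p $ k))\<^sup>2)"
    unfolding sum_split by simp
  then show ?thesis
    by (simp add: norm_vec_def L2_set_def)
qed

lemma linear_Jc: "linear (Jc u)"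
  by (rule linearI)
    (auto simp: Jc_def vec_eq_iff algebra_simps add_divide_distrib diff_divide_distrib
      scaleR_conv_of_real[where 'a = complex])

lemma smooth_Jc: "smooth_on (\<lambda>x. Jc (cplx x $ c) v) UNIV"
proof (rule smooth_on_vec[OF open_UNIV])
  show "smooth_on (\<lambda>x. Jc (cplx x $ c) v $ k) UNIV" for k
    by (cases k rule: index_cases) (auto simp: Jc_nth intro!: smooth_intros)
qed

lemma almost_hermitian_J: "almost_hermitian_structure J"
  unfolding almost_hermitian_structure_def
proof (intro conjI allI)
  show "orthogonal_transformation (J x)" for x
    unfolding orthogonal_transformation
  proof
    have "linear (realify \<circ> (Jc (cplx x $ c) \<circ> cplx))"
      by (intro linear_compose linear_realify linear_Jc linear_cplx)
    then show "linear (J x)"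
      by (simp add: J_def[abs_def] comp_def)
    show "\<forall>v. norm (J x v) = norm v"
      by (metis J_def norm_Jc norm_realify realify_cplx)
  qed
  show "J x (J x v) = - v" for x v
    using linear_neg[OF linear_realify, of "cplx v"] by (simp add: J_def Jc_Jc)
  show "smooth_on (\<lambda>x. J x v) UNIV" for v
    unfolding J_def
    by (intro smooth_on_bounded_linear_comp[OF _ bounded_linear_realify] smooth_Jc open_UNIV)
qed

lemma smooth_chart: "smooth_on (\<lambda>x. chart (cplx x)) UNIV"
  by (rule smooth_on_vec[OF open_UNIV smooth_chart_nth])

lemma smooth_chart_inv: "smooth_on (\<lambda>w. realify (chart_inv w)) UNIV"
proof -
  have "smooth_on (\<lambda>w. chart_inv w $ k) UNIV" for k
    using neqs
    by (cases k rule: index_cases) (auto simp: chart_inv_def intro!: smooth_intros)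
  then show ?thesis
    by (intro smooth_on_bounded_linear_comp[OF _ bounded_linear_realify] smooth_on_vec open_UNIV)
qed

lemma hermitian_J: "hermitian_structure J"
  unfolding hermitian_structure_def integrable_structure_def
proof (intro conjI allI almost_hermitian_J)
  fix p :: "real ^ ('m + 'm)"
  \<comment> \<open>The chart is global, so the same one serves every point
    \<open>p\<close>.\<close>
  define \<psi> where "\<psi> = (\<lambda>x :: real ^ ('m + 'm). chart (cplx x))"
  have inv1: "realify (chart_inv (\<psi> x)) = x" for x
    by (simp add: \<psi>_def chart_inv_chart)
  have inv2: "\<psi> (realify (chart_inv w)) = w" for w
    by (simp add: \<psi>_def chart_chart_inv)
  have inj: "inj \<psi>"
    by (metis inv1 injI)
  have range: "range \<psi> = UNIV"
    by (rule surjI) (rule inv2)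
  have inv_eq: "inv \<psi> = (\<lambda>w. realify (chart_inv w))"
    using inv_f_f[OF inj] inv2 by (metis ext)
  have "frechet_derivative \<psi> (at x) v = dchart (cplx x) (cplx v)" for x v
    using smooth_on_imp_differentiable[OF smooth_chart, of x]
    by (simp add: vec_eq_iff \<psi>_def frechet_derivative_nth
        frechet_derivative_eq[OF chart_has_derivative] del: chart_nth dchart_nth)
  then have "frechet_derivative \<psi> (at x) (J x v) = \<i> *s frechet_derivative \<psi> (at x) v" for x v
    by (simp add: J_def dchart_Jc)
  moreover have "smooth_chart \<psi> UNIV"
    unfolding smooth_chart_def using smooth_chart smooth_chart_inv
    by (simp add: inj range inv_eq) (simp add: \<psi>_def)
  ultimately show "\<exists>U (\<psi> :: real ^ ('m + 'm) \<Rightarrow> complex ^ 'm). p \<in> U \<and> smooth_chart \<psi> U \<and>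
      (\<forall>x\<in>U. \<forall>v. frechet_derivative \<psi> (at x) (J x v) = \<i> *s frechet_derivative \<psi> (at x) v)"
    by blast
qed

section \<open>Differentials of \<phi> and the harmonic morphism equations\<close>

lemma \<phi>_has_derivative: "(\<phi> has_derivative (\<lambda>v. D (cplx x) (cplx v))) (at x)"
  unfolding \<phi>_def[abs_def] D_def
  by (auto intro!: derivative_eq_intros simp: fun_eq_iff mult_ac simp del: chart_nth dchart_nth)

lemma D_has_derivative: "((\<lambda>x. D (cplx x) v) has_derivative (\<lambda>w. H (cplx x) v (cplx w))) (at x)"
  unfolding D_def H_def
  by (auto intro!: derivative_eq_intros sum.cong simp: fun_eq_iff algebra_simps)

lemma partial_deriv_\<phi>: "partial_deriv s \<phi> = (\<lambda>x. D (cplx x) (cplx (axis s 1)))"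
  by (simp add: fun_eq_iff partial_deriv_def frechet_derivative_eq[OF \<phi>_has_derivative])

lemma partial_deriv2_\<phi>:
  "partial_deriv s (partial_deriv s \<phi>) x = H (cplx x) (cplx (axis s 1)) (cplx (axis s 1))"
  unfolding partial_deriv_\<phi>
  by (simp add: partial_deriv_def frechet_derivative_eq[OF D_has_derivative])

text \<open>The Laplacian cancels in each coordinate plane separately: along one axis the products
  of components with distinct indices vanish, and what remains is a multiple of the square of
  \<open>t\<close> or \<open>cnj t\<close>, which changes sign between \<open>t = 1\<close> and
  \<open>t = \<i>\<close>.\<close>

lemma H_axis: "H z (axis k \<i>) (axis k \<i>) = - H z (axis k 1) (axis k 1)"
proof -
  have "(\<Sum>l\<in>-{a,b,c}. 2 * axis k \<i> $ l * axis k \<i> $ l)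
      = - (\<Sum>l\<in>-{a,b,c}. 2 * axis k 1 $ l * axis k 1 $ l :: complex)"
    by (auto simp: sum_negf[symmetric] axis_def intro!: sum.cong split: if_splits)
  then show ?thesis
    using neqs by (auto simp: H_def axis_def algebra_simps)
qed

lemma sum_axis:
  "(\<Sum>l\<in>-{a,b,c}. 2 * z $ l * axis k t $ l) = (if k \<in> {a,b,c} then 0 else 2 * z $ k * t :: complex)"
  by (auto simp: axis_def if_distrib cong: if_cong)

lemma D_axis:
  "D z (axis a t) = t + 2 * chart z $ b * (z $ c * cnj t)"
  "D z (axis b t) = 2 * chart z $ b * t - z $ c * cnj t"
  "k \<noteq> a \<Longrightarrow> k \<noteq> b \<Longrightarrow> D z (axis k t) = t * D z (axis k 1)"
  using neqs unfolding D_def sum_axis by (auto simp: axis_def algebra_simps)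

text \<open>For \<open>k\<close> other than \<open>a\<close>, \<open>b\<close>,
  \<open>D z (axis k t)\<close> is complex linear in \<open>t\<close>, so the two squares cancel.
  With \<open>s = 2 * chart z $ b\<close> and \<open>u = z $ c\<close>, the planes \<open>a\<close>
  and \<open>b\<close> contribute \<open>4 * s * u\<close> and \<open>- 4 * s * u\<close>.\<close>

lemma sum_D_squares: "(\<Sum>k\<in>UNIV. (D z (axis k 1))\<^sup>2 + (D z (axis k \<i>))\<^sup>2) = 0"
proof -
  have "(D z (axis k 1))\<^sup>2 + (D z (axis k \<i>))\<^sup>2 = 0" if "k \<in> -{a,b}" for k
    using D_axis(3)[of k z \<i>] that by (simp add: power_mult_distrib)
  then show ?thesis
    unfolding sum_split by (simp add: D_axis(1,2) power2_eq_square algebra_simps)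
qed

lemma harmonic_\<phi>: "harmonic_morphism \<phi>"
  unfolding harmonic_morphism_def
proof (intro conjI allI)
  show "smooth_on \<phi> UNIV"
    unfolding \<phi>_def[abs_def] by (intro smooth_intros smooth_chart_nth)
  show "(\<Sum>i\<in>UNIV. partial_deriv i (partial_deriv i \<phi>) x) = 0" for x
    by (simp add: partial_deriv2_\<phi> sum_UNIV_Plus cplx_axis H_axis)
  show "(\<Sum>i\<in>UNIV. (partial_deriv i \<phi> x)\<^sup>2) = 0" for x
    by (simp add: partial_deriv_\<phi> sum_UNIV_Plus cplx_axis sum_D_squares)
qed

lemma differentiable_\<phi>: "\<phi> differentiable (at x)"
  using \<phi>_has_derivative differentiable_def by blast

lemma holomorphic_\<phi>: "holomorphic_wrt J \<phi>"
  by (simp add: holomorphic_wrt_def differentiable_\<phi> frechet_derivative_eq[OF \<phi>_has_derivative]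
      J_def D_Jc)

section \<open>Submersivity\<close>

lemma linear_D: "linear (\<lambda>v. D z (cplx v))"
  using \<phi>_has_derivative[of "realify z"] by (simp add: has_derivative_linear)

lemma submersive_\<phi>: "submersive \<phi>"
  unfolding submersive_def
proof (intro conjI allI differentiable_\<phi>)
  fix x :: "real ^ ('m + 'm)"
  let ?D = "\<lambda>v. D (cplx x) (cplx v)"
  \<comment> \<open>This combination isolates the part linear in \<open>t\<close> of
    \<open>D z (axis a t)\<close>, whose coefficient is 1 at every point; so one of the two values
    is nonzero.\<close>
  have "D (cplx x) (axis a 1) - \<i> * D (cplx x) (axis a \<i>) = 2"
    unfolding D_axis by (simp add: algebra_simps)
  then obtain e where e: "D (cplx x) e \<noteq> 0"
    by force
  have "\<exists>v. ?D v = y" for y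
  proof -
    define r where "r = y / D (cplx x) e"
    \<comment> \<open>By holomorphy \<open>J x\<close> acts on values of \<open>D\<close> as \<i>,
      so real combinations of \<open>e\<close> and its image under \<open>J x\<close> reach every
      complex multiple of \<open>D (cplx x) e\<close>.\<close>
    let ?v = "Re r *\<^sub>R realify e + Im r *\<^sub>R J x (realify e)"
    have "?D ?v = Re r *\<^sub>R ?D (realify e) + Im r *\<^sub>R ?D (J x (realify e))"
      using linear_add[OF linear_D] linear_scale[OF linear_D] by metis
    also have "\<dots> = (Re r + \<i> * Im r) * D (cplx x) e"
      by (simp add: J_def D_Jc scaleR_conv_of_real algebra_simps)
    also have "\<dots> = y"
      using e by (simp add: complex_eq[symmetric] r_def)
    finally show ?thesis ..
  qed
  then have "surj ?D"
    by (metis surjI)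
  then show "surj (frechet_derivative \<phi> (at x))"
    by (simp add: frechet_derivative_eq[OF \<phi>_has_derivative, abs_def])
qed

section \<open>Fullness and exclusion of Kaehler structures\<close>

text \<open>The differentials of \<open>\<phi>\<close> at the points \<open>0\<close> and \<open>axis k t\<close> with \<open>k \<noteq> c\<close> already
  span all \<open>dq\<^sub>j\<close> over the complex numbers.\<close>

lemma D_proportional_imp:
  assumes eq: "\<And>z. D z v' = l * D z v"
  shows "v' = l *s v"
proof -
  have a: "v' $ a = l * v $ a"
    using eq[of 0] by (simp add: D_def)
  have D_b: "D (axis b t) w = w $ a - w $ c * cnj t + 2 * t * w $ b" for t w
  proof -
    have "(\<Sum>k\<in>-{a,b,c}. 2 * axis b t $ k * w $ k) = 0"
      by (rule sum.neutral) (auto simp: axis_def)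
    then show ?thesis
      using neqs by (simp add: D_def axis_def)
  qed
  \<comment> \<open>As \<open>cnj t\<close> is \<open>t\<close> for \<open>t = 1\<close> and
    \<open>- t\<close> for \<open>t = \<i>\<close>, the two points give \<open>2 * v $ b\<close>
    minus and plus \<open>v $ c\<close>, which determine both components.\<close>
  have "2 * v' $ b - v' $ c = l * (2 * v $ b - v $ c)"
    using eq[of "axis b 1"] a by (simp add: D_b algebra_simps)
  moreover have "\<i> * (2 * v' $ b + v' $ c) = \<i> * (l * (2 * v $ b + v $ c))"
    using eq[of "axis b \<i>"] a by (simp add: D_b algebra_simps)
  then have "2 * v' $ b + v' $ c = l * (2 * v $ b + v $ c)"
    by simp
  ultimately have "4 * v' $ b = 4 * (l * v $ b)" "2 * v' $ c = 2 * (l * v $ c)"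
    by (simp_all add: algebra_simps) algebra+
  then have bc: "v' $ b = l * v $ b" "v' $ c = l * v $ c"
    by simp_all
  have rest: "v' $ k = l * v $ k" if k: "k \<notin> {a,b,c}" for k
  proof -
    have "D (axis k 1) w = w $ a + 2 * w $ k" for w
    proof -
      have "(\<Sum>j\<in>-{a,b,c}. 2 * axis k 1 $ j * w $ j) = (\<Sum>j\<in>-{a,b,c}. if j = k then 2 * w $ k else 0)"
        by (rule sum.cong) (auto simp: axis_def)
      also have "\<dots> = 2 * w $ k"
        using k by simp
      finally show ?thesis
        using neqs k by (auto simp: D_def axis_def)
    qed
    then show ?thesis
      using eq[of "axis k 1"] a by (simp add: algebra_simps)
  qed
  have "v' $ k = l * v $ k" for k
    using a bc rest[of k] by (cases "k \<in> {a,b,c}") auto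
  then show ?thesis
    by (simp add: vec_eq_iff)
qed

lemma full_\<phi>: "full \<phi>"
  unfolding full_def
proof (rule notI, elim exE conjE)
  fix A P \<psi>
  assume A: "subspace A" "A \<noteq> (UNIV :: (real ^ ('m + 'm)) set)"
    and P: "orthogonal_projection_onto A P" and \<phi>: "\<phi> = \<psi> \<circ> P"
  have P: "P x \<in> A" "\<And>y. y \<in> A \<Longrightarrow> orthogonal (x - P x) y" for x
    using P by (auto simp: orthogonal_projection_onto_def)
  obtain x where x: "x \<notin> A"
    using A(2) by auto
  define v where "v = x - P x"
  have "v \<noteq> 0"
    using x P(1)[of x] by (auto simp: v_def)
  have v: "orthogonal v y" if "y \<in> A" for y
    using P(2) that by (simp add: v_def)
  \<comment> \<open>Linearity of \<open>P\<close> is not among the assumptions. Instead, the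
    difference of the two values lies in \<open>A\<close> and is orthogonal to \<open>A\<close>,
    hence to itself.\<close>
  have "P (y + t *\<^sub>R v) = P y" for y t
  proof -
    let ?d = "P (y + t *\<^sub>R v) - P y"
    have d: "?d \<in> A"
      using A(1) P(1) by (intro subspace_diff)
    have "?d = (y - P y) - (y + t *\<^sub>R v - P (y + t *\<^sub>R v)) + t *\<^sub>R v"
      by simp
    moreover have "orthogonal \<dots> ?d"
      using P(2)[OF d, of y] P(2)[OF d, of "y + t *\<^sub>R v"] v[OF d]
      by (simp only: orthogonal_def inner_diff_left inner_add_left inner_scaleR_left)
    ultimately have "orthogonal ?d ?d"
      by metis
    then show ?thesis
      by (simp add: orthogonal_def)
  qed
  then have const: "\<phi> (y + t *\<^sub>R v) = \<phi> y" for y t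
    by (simp add: \<phi>)
  \<comment> \<open>\<phi> is constant along lines in the direction \<open>v\<close>, so the chain
    rule makes every differential vanish on \<open>v\<close>; then \<open>D_proportional_imp\<close>
    applies with factor 0.\<close>
  have "D z (cplx v) = 0" for z
  proof -
    let ?y = "realify z"
    have "((\<lambda>t. ?y + t *\<^sub>R v) has_derivative (\<lambda>t. t *\<^sub>R v)) (at 0)"
      by (auto intro!: derivative_eq_intros)
    from diff_chain_at[OF this, of \<phi>] \<phi>_has_derivative[of ?y]
    have "(\<phi> \<circ> (\<lambda>t. ?y + t *\<^sub>R v) has_derivative (\<lambda>v. D z (cplx v)) \<circ> (\<lambda>t. t *\<^sub>R v)) (at 0)"
      by simp
    moreover have "\<phi> \<circ> (\<lambda>t. ?y + t *\<^sub>R v) = (\<lambda>t. \<phi> ?y)"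
      by (simp add: const fun_eq_iff)
    ultimately have "(\<lambda>v. D z (cplx v)) \<circ> (\<lambda>t. t *\<^sub>R v) = (\<lambda>t. 0)"
      by (metis has_derivative_const has_derivative_unique)
    from fun_cong[OF this, of 1] show ?thesis
      by simp
  qed
  then have "cplx v = 0 *s cplx v"
    by (intro D_proportional_imp) simp
  then have "cplx v = 0"
    by (simp add: vec_eq_iff)
  then show False
    using \<open>v \<noteq> 0\<close> linear_0[OF linear_realify] by (metis realify_cplx)
qed

text \<open>A parallel structure for which \<open>\<phi>\<close> is holomorphic must be multiplication by \<open>\<i>\<close>, but
  \<open>d\<phi> = dq\<^sub>a - d(cnj q\<^sub>b)\<close> at the point \<open>axis c 1\<close>.\<close>

lemma not_kaehler_\<phi>: "\<not> (\<exists>K. kaehler_structure K \<and> holomorphic_wrt K \<phi>)"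
proof safe
  fix K
  assume K: "kaehler_structure K" "holomorphic_wrt K \<phi>"
  have hol: "D z (cplx (K 0 v)) = \<i> * D z (cplx v)" for z v
  proof -
    have "K 0 = K (realify z)"
      using K(1) by (auto simp: kaehler_structure_def)
    then show ?thesis
      using K(2) unfolding holomorphic_wrt_def frechet_derivative_eq[OF \<phi>_has_derivative]
      by (metis cplx_realify)
  qed
  have "cplx (K 0 v) = \<i> *s cplx v" for v
    by (rule D_proportional_imp) (rule hol)
  moreover have "\<i> *s axis b 1 = axis b \<i>"
    by (simp add: vec_eq_iff axis_def)
  ultimately have "D (axis c 1) (axis b \<i>) = \<i> * D (axis c 1) (axis b 1)"
    using hol[of "axis c 1" "realify (axis b 1)"] by simp
  then show False
    \<comment> \<open>At \<open>axis c 1\<close> the \<open>b\<close> component of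
      \<open>chart\<close> is 0, so \<open>D\<close> sends \<open>axis b t\<close> to
      \<open>- cnj t\<close>, which is antilinear in \<open>t\<close>.\<close>
    using neqs unfolding D_axis by (simp add: axis_def)
qed

end

theorem theorem4p17:
  assumes "CARD('m::finite) > 2"
  shows "\<exists>\<phi> :: real ^ ('m + 'm) \<Rightarrow> complex.
           harmonic_morphism \<phi> \<and> full \<phi> \<and> submersive \<phi> \<and>
           (\<exists>J. hermitian_structure J \<and> holomorphic_wrt J \<phi>) \<and>
           \<not> (\<exists>J. kaehler_structure J \<and> holomorphic_wrt J \<phi>)"
proof -
  obtain T :: "'m set" where "card T = 3"
    using obtain_subset_with_card_n[of 3 "UNIV :: 'm set"] assms by auto
  then obtain a b c :: 'm where "a \<noteq> b" "a \<noteq> c" "b \<noteq> c"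
    by (auto simp: card_3_iff)
  then interpret distinct_triple a b c
    by unfold_locales
  show ?thesis
    using harmonic_\<phi> full_\<phi> submersive_\<phi> hermitian_J holomorphic_\<phi> not_kaehler_\<phi> by blast
qed

end
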